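(* Let $q$ be a non-zero real number, $\omega$ a real number, and let $P_n(\omega)$ be the path on $n\ge 2$ vertices with potential $\omega$ assigned only at the end vertices. Then, for states $\mathbf{x}$ and $\mathbf{y}$, $P_n(\omega)$ exhibits $q$-Laplacian perfect state transfer (respectively, pretty good state transfer) between $\mathbf{x}$ and $\mathbf{y}$ if and only if $P_n((1-\omega)q)$ exhibits perfect state transfer (respectively, pretty good state transfer) between $\mathbf{x}$ and $\mathbf{y}$ with respect to its adjacency matrix.
   Context: $P_n$ is the path on vertices $1,\dots,n$ with $j,k$ adjacent iff $|j-k|=1$, with adjacency matrix $A$ and diagonal degree matrix $\Delta$. $P_n(\omega)$ has potential $\omega$ at vertices $1$ and $n$ and no potential elsewhere; let $\Delta'=\omega(\mathbf{e}_1\mathbf{e}_1^T+\mathbf{e}_n\mathbf{e}_n^T)$, where $\mathbf{e}_j$ is the $j$th standard basis vector. The $q$-Laplacian matrix of $P_n(\omega)$ is $\mathscr{L}=(1-q^2)I+q^2(\Delta+\Delta')-qA$, equivalently $(1+q^2)I+(\omega-1)q^2(\mathbf{e}_1\mathbf{e}_1^T+\mathbf{e}_n\mathbf{e}_n^T)-qA$. The adjacency matrix of $P_n(\omega')$ is $A+\omega'(\mathbf{e}_1\mathbf{e}_1^T+\mathbf{e}_n\mathbf{e}_n^T)$. A state is a real unit vector in $\mathbb{R}^n$. Relative to a real symmetric matrix $B$, perfect state transfer occurs between $\mathbf{x}$ and $\mathbf{y}$ if $\exp(i\tau B)\mathbf{x}=\gamma\mathbf{y}$ for some $\tau>0$,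 $\gamma\in\mathbb{C}$; pretty good state transfer occurs between linearly independent $\mathbf{x}$ and $\mathbf{y}$ if $\lim_{k\to\infty}\exp(i\tau_kB)\mathbf{x}=\gamma\mathbf{y}$ for some real sequence $(\tau_k)$ and $\gamma\in\mathbb{C}$ with $|\gamma|=1$. *)

theory Defs
  imports Complex_Main "Jordan_Normal_Form.Matrix"
begin

text \<open>Graphs have vertex set \<open>{0..<n}\<close> and are given by an adjacency relation \<open>E\<close>;
  vertex \<open>k\<close> here is the vertex usually numbered \<open>k + 1\<close>.
  A potential is a function from vertices to the reals.\<close>

definition adjacency_mat :: "nat \<Rightarrow> (nat \<Rightarrow> nat \<Rightarrow> bool) \<Rightarrow> real mat" where
  "adjacency_mat n E = mat n n (\<lambda>(i, j). if E i j then 1 else 0)"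

definition degree_mat :: "nat \<Rightarrow> (nat \<Rightarrow> nat \<Rightarrow> bool) \<Rightarrow> real mat" where
  "degree_mat n E = mat_diag n (\<lambda>i. real (card {j. j < n \<and> E i j}))"

definition potential_adjacency_mat ::
  "nat \<Rightarrow> (nat \<Rightarrow> nat \<Rightarrow> bool) \<Rightarrow> (nat \<Rightarrow> real) \<Rightarrow> real mat" where
  "potential_adjacency_mat n E p = adjacency_mat n E + mat_diag n p"

definition potential_q_laplacian_mat ::
  "real \<Rightarrow> nat \<Rightarrow> (nat \<Rightarrow> nat \<Rightarrow> bool) \<Rightarrow> (nat \<Rightarrow> real) \<Rightarrow> real mat" where
  "potential_q_laplacian_mat q n E p =
     (1 - q\<^sup>2) \<cdot>\<^sub>m 1\<^sub>m n + q\<^sup>2 \<cdot>\<^sub>m (degree_mat n E + mat_diag n p) - q \<cdot>\<^sub>m adjacency_mat n E"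

definition path_adj :: "nat \<Rightarrow> nat \<Rightarrow> bool" where
  "path_adj j k \<longleftrightarrow> \<bar>int j - int k\<bar> = 1"

text \<open>For \<open>n \<ge> 2\<close> the two end vertices are distinct.\<close>

definition end_potential :: "nat \<Rightarrow> real \<Rightarrow> nat \<Rightarrow> real" where
  "end_potential n \<omega> i = (if i = 0 \<or> i = n - 1 then \<omega> else 0)"

definition path_adjacency :: "nat \<Rightarrow> real \<Rightarrow> real mat" where
  "path_adjacency n \<omega> = potential_adjacency_mat n path_adj (end_potential n \<omega>)"

definition path_q_laplacian :: "real \<Rightarrow> nat \<Rightarrow> real \<Rightarrow> real mat" where
  "path_q_laplacian q n \<omega> = potential_q_laplacian_mat q n path_adj (end_potential n \<omega>)"

text \<open>The exponential series of a square matrix, summed entrywise (it always converges).\<close>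

definition mat_exp :: "complex mat \<Rightarrow> complex mat" where
  "mat_exp M = mat (dim_row M) (dim_row M) (\<lambda>(i, j). \<Sum>k. (M ^\<^sub>m k) $$ (i, j) / fact k)"

definition transition_mat :: "real mat \<Rightarrow> real \<Rightarrow> complex mat" where
  "transition_mat B \<tau> = mat_exp ((\<i> * complex_of_real \<tau>) \<cdot>\<^sub>m map_mat complex_of_real B)"

definition state :: "nat \<Rightarrow> real vec \<Rightarrow> bool" where
  "state n x \<longleftrightarrow> x \<in> carrier_vec n \<and> sqrt (x \<bullet> x) = 1"

definition perfect_state_transfer :: "real mat \<Rightarrow> real vec \<Rightarrow> real vec \<Rightarrow> bool" where
  "perfect_state_transfer B x y \<longleftrightarrow>
     (\<exists>\<tau> \<gamma>. \<tau> > 0 \<and>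
       transition_mat B \<tau> *\<^sub>v map_vec complex_of_real x = \<gamma> \<cdot>\<^sub>v map_vec complex_of_real y)"

text \<open>Linear independence of the pair \<open>(x, y)\<close>; in particular \<open>x \<noteq> y\<close>.\<close>

definition lin_indep_pair :: "real vec \<Rightarrow> real vec \<Rightarrow> bool" where
  "lin_indep_pair x y \<longleftrightarrow>
     (\<forall>a b. a \<cdot>\<^sub>v x + b \<cdot>\<^sub>v y = 0\<^sub>v (dim_vec y) \<longrightarrow> a = 0 \<and> b = 0)"

text \<open>The limit of vectors is taken coordinatewise, which in finite dimension is the
  limit in norm.\<close>

definition pretty_good_state_transfer :: "real mat \<Rightarrow> real vec \<Rightarrow> real vec \<Rightarrow> bool" where
  "pretty_good_state_transfer B x y \<longleftrightarrow>
     lin_indep_pair x y \<and>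
     (\<exists>(\<tau> :: nat \<Rightarrow> real) \<gamma>. cmod \<gamma> = 1 \<and>
       (\<forall>j < dim_vec y.
          (\<lambda>k. (transition_mat B (\<tau> k) *\<^sub>v map_vec complex_of_real x) $ j)
            \<longlonglongrightarrow> (\<gamma> \<cdot>\<^sub>v map_vec complex_of_real y) $ j))"

end

theory Submission
  imports "HOL-Analysis.Topology_Euclidean_Space" Defs
begin

text \<open>
  Write \<open>L\<close> for the \<open>q\<close>-Laplacian of the path with potential \<open>\<omega>\<close> at its ends. Since every inner
  vertex has degree 2 and the two end vertices have degree 1, the degree deficit at the ends acts
  like a potential: \<open>L = (1 + q\<^sup>2) I - q B\<close>, where \<open>B\<close> is the adjacency matrix of the path with
  potential \<open>(1 - \<omega>) q\<close> at its ends (\<open>path_q_laplacian_affine\<close>). So it suffices that state transfer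
  is invariant under \<open>B \<mapsto> c I + d B\<close> for all real \<open>c\<close> and \<open>d \<noteq> 0\<close>
  (\<open>perfect_state_transfer_affine\<close>, \<open>pretty_good_state_transfer_affine\<close>).

  This invariance rests on \<open>exp (i \<tau> (c I + d B)) = e\<^bsup>i \<tau> c\<^esup> exp (i (\<tau> d) B)\<close>
  (\<open>transition_mat_affine\<close>): the map rescales time by \<open>d\<close> and introduces a phase that depends on time.
  Two points need care.

  \<^item> Perfect state transfer asks for a positive time, while \<open>d\<close> may be negative, as it is here for
    \<open>q > 0\<close>. Because \<open>B\<close> and the states are real, complex conjugation reverses time and only
    conjugates the phase \<open>\<gamma>\<close>.

  \<^item> In pretty good state transfer the phases \<open>e\<^bsup>i \<tau>\<^sub>k c\<^esup>\<close> need not converge along the given times.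
    The unit circle is compact, so they do along a subsequence, which is as good.

  Each property has to be transported in one direction only, because affine maps with \<open>d \<noteq> 0\<close>
  are invertible.
\<close>

section \<open>Powers of a matrix shifted by a multiple of the identity\<close>

text \<open>Pascal's rule, as needed for the induction step of a binomial expansion: \<open>a m\<close> plays the
  part of the \<open>m\<close>-th power, and multiplication by \<open>c + z\<close> turns \<open>a m\<close> into \<open>c * a m + a (Suc m)\<close>.\<close>

lemma binomial_shift_sum:
  fixes c :: "'a :: comm_ring_1"
  shows "(\<Sum>m\<le>Suc k. of_nat (Suc k choose m) * c ^ (Suc k - m) * a m)
       = (\<Sum>m\<le>k. of_nat (k choose m) * c ^ (k - m) * (c * a m + a (Suc m)))"
proof -
  have "(\<Sum>m\<le>Suc k. of_nat (Suc k choose m) * c ^ (Suc k - m) * a m)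
      = c ^ Suc k * a 0 + (\<Sum>m\<le>k. of_nat (k choose Suc m) * c ^ (k - m) * a (Suc m))
        + (\<Sum>m\<le>k. of_nat (k choose m) * c ^ (k - m) * a (Suc m))"
    by (subst sum.atMost_Suc_shift) (simp add: algebra_simps sum.distrib)
  also have "c ^ Suc k * a 0 + (\<Sum>m\<le>k. of_nat (k choose Suc m) * c ^ (k - m) * a (Suc m))
      = (\<Sum>m\<le>Suc k. of_nat (k choose m) * c ^ (Suc k - m) * a m)"
    by (subst sum.atMost_Suc_shift) simp
  also have "\<dots> = (\<Sum>m\<le>k. of_nat (k choose m) * c ^ (k - m) * (c * a m))"
    by (simp add: Suc_diff_le binomial_eq_0 algebra_simps)
  finally show ?thesis
    by (simp add: algebra_simps sum.distrib)
qed

lemma pow_mat_Suc_index: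
  assumes "M \<in> carrier_mat n n" "i < n" "j < n"
  shows "(M ^\<^sub>m Suc k) $$ (i, j) = (\<Sum>l<n. (M ^\<^sub>m k) $$ (i, l) * M $$ (l, j))"
proof -
  have "M ^\<^sub>m k \<in> carrier_mat n n" by (rule pow_carrier_mat[OF assms(1)])
  then show ?thesis using assms
    by (auto simp: scalar_prod_def atLeast0LessThan intro!: sum.cong)
qed

text \<open>The binomial theorem holds because the identity matrix commutes with \<open>M\<close>. It is stated for
  entries since the exponential is summed entrywise.\<close>

lemma pow_mat_shift_index:
  fixes M :: "'a :: comm_ring_1 mat"
  assumes M: "M \<in> carrier_mat n n" and i: "i < n"
  shows "j < n \<Longrightarrow> ((c \<cdot>\<^sub>m 1\<^sub>m n + M) ^\<^sub>m k) $$ (i, j)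
      = (\<Sum>m\<le>k. of_nat (k choose m) * c ^ (k - m) * (M ^\<^sub>m m) $$ (i, j))"
proof (induction k arbitrary: j)
  case 0
  then show ?case using M i by simp
next
  case (Suc k)
  let ?S = "c \<cdot>\<^sub>m 1\<^sub>m n + M"
  let ?w = "\<lambda>m. of_nat (k choose m) * c ^ (k - m) :: 'a"
  have S: "?S \<in> carrier_mat n n" using M by simp
  have "(?S ^\<^sub>m Suc k) $$ (i, j) = (\<Sum>l<n. (?S ^\<^sub>m k) $$ (i, l) * ?S $$ (l, j))"
    by (rule pow_mat_Suc_index[OF S i Suc.prems])
  also have "\<dots> = (\<Sum>l<n. (?S ^\<^sub>m k) $$ (i, l) * (if l = j then c else 0)
                    + (?S ^\<^sub>m k) $$ (i, l) * M $$ (l, j))"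
    using M Suc.prems by (intro sum.cong refl) (auto simp: algebra_simps)
  also have "\<dots> = c * (?S ^\<^sub>m k) $$ (i, j) + (\<Sum>l<n. (?S ^\<^sub>m k) $$ (i, l) * M $$ (l, j))"
    using Suc.prems by (simp add: sum.distrib if_distrib[of "\<lambda>z. _ * z"] cong: if_cong)
  also have "(\<Sum>l<n. (?S ^\<^sub>m k) $$ (i, l) * M $$ (l, j))
      = (\<Sum>l<n. \<Sum>m\<le>k. ?w m * ((M ^\<^sub>m m) $$ (i, l) * M $$ (l, j)))"
    by (intro sum.cong refl) (simp add: Suc.IH sum_distrib_right mult.assoc)
  also have "\<dots> = (\<Sum>m\<le>k. ?w m * (\<Sum>l<n. (M ^\<^sub>m m) $$ (i, l) * M $$ (l, j)))"
    by (subst sum.swap) (simp add: sum_distrib_left)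
  also have "\<dots> = (\<Sum>m\<le>k. ?w m * (M ^\<^sub>m Suc m) $$ (i, j))"
    by (simp only: pow_mat_Suc_index[OF M i Suc.prems])
  also have "c * (?S ^\<^sub>m k) $$ (i, j) + \<dots>
      = (\<Sum>m\<le>k. ?w m * (c * (M ^\<^sub>m m) $$ (i, j) + (M ^\<^sub>m Suc m) $$ (i, j)))"
    by (simp add: Suc.IH[OF Suc.prems] sum_distrib_left sum.distrib algebra_simps)
  finally show ?case by (simp only: binomial_shift_sum)
qed

section \<open>The matrix exponential\<close>

text \<open>The sum \<open>K\<close> of the moduli of all entries dominates the modulus sum of each column, so one more
  factor \<open>M\<close> costs at most a factor \<open>K\<close>. Hence the exponential series converges absolutely in
  every entry.\<close>

lemma pow_mat_index_bound:
  fixes M :: "complex mat"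
  assumes M: "M \<in> carrier_mat n n" and i: "i < n"
  shows "j < n \<Longrightarrow> cmod ((M ^\<^sub>m k) $$ (i, j)) \<le> (\<Sum>m<n. \<Sum>l<n. cmod (M $$ (l, m))) ^ k"
proof (induction k arbitrary: j)
  case 0
  then show ?case using M i by simp
next
  case (Suc k)
  define K where "K = (\<Sum>m<n. \<Sum>l<n. cmod (M $$ (l, m)))"
  have K: "(\<Sum>l<n. cmod (M $$ (l, j))) \<le> K"
    unfolding K_def using Suc.prems
    by (intro member_le_sum[of j "{..<n}" "\<lambda>m. \<Sum>l<n. cmod (M $$ (l, m))"]) (auto intro: sum_nonneg)
  have K0: "K \<ge> 0" unfolding K_def by (intro sum_nonneg) auto
  have "cmod ((M ^\<^sub>m Suc k) $$ (i, j)) \<le> (\<Sum>l<n. cmod ((M ^\<^sub>m k) $$ (i, l)) * cmod (M $$ (l, j)))"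
    unfolding pow_mat_Suc_index[OF M i Suc.prems]
    by (rule order.trans[OF norm_sum]) (simp add: norm_mult)
  also have "\<dots> \<le> (\<Sum>l<n. K ^ k * cmod (M $$ (l, j)))"
    using Suc.IH by (intro sum_mono mult_right_mono) (auto simp: K_def)
  also have "\<dots> = K ^ k * (\<Sum>l<n. cmod (M $$ (l, j)))" by (simp add: sum_distrib_left)
  also have "\<dots> \<le> K ^ k * K" using K K0 by (intro mult_left_mono) auto
  finally show ?case by (simp add: K_def mult.commute)
qed

lemma summable_norm_mat_exp:
  fixes M :: "complex mat"
  assumes "M \<in> carrier_mat n n" "i < n" "j < n"
  shows "summable (\<lambda>k. cmod ((M ^\<^sub>m k) $$ (i, j) / fact k))"
proof -
  define K where "K = (\<Sum>m<n. \<Sum>l<n. cmod (M $$ (l, m)))"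
  have "summable (\<lambda>k. inverse (fact k) * K ^ k)" by (rule summable_exp)
  then show ?thesis
    by (rule summable_comparison_test'[where N = 0])
       (use pow_mat_index_bound[OF assms] in
        \<open>auto simp: norm_divide K_def field_simps\<close>)
qed

text \<open>By the binomial expansion, the entrywise series on the left is the Cauchy product of the
  series for \<open>mat_exp M\<close> with the one for \<open>exp c\<close>, and both converge absolutely.\<close>

lemma mat_exp_shift:
  assumes M: "M \<in> carrier_mat n n"
  shows "mat_exp (c \<cdot>\<^sub>m 1\<^sub>m n + M) = exp c \<cdot>\<^sub>m mat_exp M"
proof (rule eq_matI)
  show "dim_row (mat_exp (c \<cdot>\<^sub>m 1\<^sub>m n + M)) = dim_row (exp c \<cdot>\<^sub>m mat_exp M)"
       "dim_col (mat_exp (c \<cdot>\<^sub>m 1\<^sub>m n + M)) = dim_col (exp c \<cdot>\<^sub>m mat_exp M)"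
    using M by (auto simp: mat_exp_def)
  fix i j assume "i < dim_row (exp c \<cdot>\<^sub>m mat_exp M)" "j < dim_col (exp c \<cdot>\<^sub>m mat_exp M)"
  then have i: "i < n" and j: "j < n" using M by (auto simp: mat_exp_def)
  let ?a = "\<lambda>k. (M ^\<^sub>m k) $$ (i, j) / fact k"
  let ?e = "\<lambda>k. c ^ k / fact k"
  have term_eq: "((c \<cdot>\<^sub>m 1\<^sub>m n + M) ^\<^sub>m k) $$ (i, j) / fact k = (\<Sum>m\<le>k. ?a m * ?e (k - m))" for k
    unfolding pow_mat_shift_index[OF M i j] sum_divide_distrib
    by (intro sum.cong refl) (simp add: binomial_fact)
  have e: "?e sums exp c" using exp_converges[of c] by (simp add: scaleR_conv_of_real divide_inverse mult.commute)
  have ne: "summable (\<lambda>k. cmod (?e k))"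
    using summable_norm_exp[of c] by (simp add: scaleR_conv_of_real divide_inverse mult.commute norm_mult norm_inverse norm_power)
  have "(\<Sum>k. \<Sum>m\<le>k. ?a m * ?e (k - m)) = suminf ?a * suminf ?e"
    by (rule Cauchy_product[symmetric, OF summable_norm_mat_exp[OF M i j] ne])
  also have "\<dots> = exp c * suminf ?a" using sums_unique[OF e] by simp
  finally show "mat_exp (c \<cdot>\<^sub>m 1\<^sub>m n + M) $$ (i, j) = (exp c \<cdot>\<^sub>m mat_exp M) $$ (i, j)"
    using M i j by (simp add: mat_exp_def term_eq)
qed

lemma pow_mat_cnj_index:
  assumes M: "M \<in> carrier_mat n n" and i: "i < n"
  shows "j < n \<Longrightarrow> (map_mat cnj M ^\<^sub>m k) $$ (i, j) = cnj ((M ^\<^sub>m k) $$ (i, j))"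
proof (induction k arbitrary: j)
  case 0
  then show ?case using M i by simp
next
  case (Suc k)
  have C: "map_mat cnj M \<in> carrier_mat n n" using M by simp
  show ?case
    unfolding pow_mat_Suc_index[OF M i Suc.prems] pow_mat_Suc_index[OF C i Suc.prems]
    using M Suc by (auto intro!: sum.cong)
qed

lemma mat_exp_cnj:
  assumes M: "M \<in> carrier_mat n n"
  shows "mat_exp (map_mat cnj M) = map_mat cnj (mat_exp M)"
proof (rule eq_matI)
  fix i j assume "i < dim_row (map_mat cnj (mat_exp M))" "j < dim_col (map_mat cnj (mat_exp M))"
  then have i: "i < n" and j: "j < n" using M by (auto simp: mat_exp_def)
  have "(\<lambda>k. (M ^\<^sub>m k) $$ (i, j) / fact k) sums mat_exp M $$ (i, j)"
    using summable_sums[OF summable_norm_cancel[OF summable_norm_mat_exp[OF M i j]]] M i j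
    by (simp add: mat_exp_def)
  then have "(\<lambda>k. cnj ((M ^\<^sub>m k) $$ (i, j) / fact k)) sums cnj (mat_exp M $$ (i, j))"
    by (simp only: sums_cnj)
  then show "mat_exp (map_mat cnj M) $$ (i, j) = map_mat cnj (mat_exp M) $$ (i, j)"
    using M i j sums_unique by (fastforce simp: mat_exp_def pow_mat_cnj_index[OF M i j])
qed (use M in \<open>auto simp: mat_exp_def\<close>)

section \<open>Transition matrices\<close>

lemma transition_mat_carrier:
  "B \<in> carrier_mat n n \<Longrightarrow> transition_mat B \<tau> \<in> carrier_mat n n"
  by (auto simp: transition_mat_def mat_exp_def)

lemma transition_mat_affine:
  assumes B: "B \<in> carrier_mat n n"
  shows "transition_mat (c \<cdot>\<^sub>m 1\<^sub>m n + d \<cdot>\<^sub>m B) \<tau> = cis (\<tau> * c) \<cdot>\<^sub>m transition_mat B (\<tau> * d)"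
proof -
  let ?M = "(\<i> * complex_of_real (\<tau> * d)) \<cdot>\<^sub>m map_mat complex_of_real B"
  have M: "?M \<in> carrier_mat n n" using B by simp
  have "(\<i> * complex_of_real \<tau>) \<cdot>\<^sub>m map_mat complex_of_real (c \<cdot>\<^sub>m 1\<^sub>m n + d \<cdot>\<^sub>m B)
      = (\<i> * complex_of_real (\<tau> * c)) \<cdot>\<^sub>m 1\<^sub>m n + ?M"
    using B by (intro eq_matI) (auto simp: algebra_simps)
  then show ?thesis
    by (simp only: transition_mat_def mat_exp_shift[OF M] cis_conv_exp)
qed

text \<open>Time reversal: for a real matrix, negating the time conjugates the transition matrix, and
  real vectors are fixed by conjugation.\<close>

lemma transition_mat_uminus_mult_real:
  assumes B: "B \<in> carrier_mat n n" and x: "x \<in> carrier_vec n"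
    and eq: "transition_mat B \<tau> *\<^sub>v map_vec complex_of_real x = \<gamma> \<cdot>\<^sub>v map_vec complex_of_real y"
  shows "transition_mat B (- \<tau>) *\<^sub>v map_vec complex_of_real x = cnj \<gamma> \<cdot>\<^sub>v map_vec complex_of_real y"
proof -
  have M: "(\<i> * complex_of_real \<tau>) \<cdot>\<^sub>m map_mat complex_of_real B \<in> carrier_mat n n" using B by simp
  have "(\<i> * complex_of_real (- \<tau>)) \<cdot>\<^sub>m map_mat complex_of_real B
      = map_mat cnj ((\<i> * complex_of_real \<tau>) \<cdot>\<^sub>m map_mat complex_of_real B)"
    by (intro eq_matI) auto
  then have neg: "transition_mat B (- \<tau>) = map_mat cnj (transition_mat B \<tau>)"
    by (simp only: transition_mat_def mat_exp_cnj[OF M])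
  have T: "transition_mat B \<tau> \<in> carrier_mat n n" by (rule transition_mat_carrier[OF B])
  have "map_mat cnj (transition_mat B \<tau>) *\<^sub>v map_vec complex_of_real x
      = map_vec cnj (transition_mat B \<tau> *\<^sub>v map_vec complex_of_real x)"
    using T x by (intro eq_vecI) (auto simp: scalar_prod_def intro!: sum.cong)
  also have "\<dots> = cnj \<gamma> \<cdot>\<^sub>v map_vec complex_of_real y"
    unfolding eq by (intro eq_vecI) auto
  finally show ?thesis by (simp only: neg)
qed

lemma transition_mat_affine_mult_vec:
  assumes "B \<in> carrier_mat n n" "d \<noteq> 0" "v \<in> carrier_vec n"
  shows "transition_mat (c \<cdot>\<^sub>m 1\<^sub>m n + d \<cdot>\<^sub>m B) (\<tau> / d) *\<^sub>v v
       = cis (\<tau> / d * c) \<cdot>\<^sub>v (transition_mat B \<tau> *\<^sub>v v)"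
  using assms transition_mat_carrier[OF assms(1), of \<tau>]
  by (auto simp: transition_mat_affine intro!: eq_vecI)

section \<open>Invariance of state transfer under affine maps\<close>

lemma perfect_state_transfer_affine_imp:
  assumes B: "B \<in> carrier_mat n n" and d: "d \<noteq> 0" and x: "x \<in> carrier_vec n"
    and "perfect_state_transfer B x y"
  shows "perfect_state_transfer (c \<cdot>\<^sub>m 1\<^sub>m n + d \<cdot>\<^sub>m B) x y"
proof -
  obtain \<tau> \<gamma> where \<tau>: "\<tau> > 0"
    and eq: "transition_mat B \<tau> *\<^sub>v map_vec complex_of_real x = \<gamma> \<cdot>\<^sub>v map_vec complex_of_real y"
    using assms unfolding perfect_state_transfer_def by blast
  \<comment> \<open>Reverse time if \<open>d\<close> is negative, so that the rescaled time is positive.\<close>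
  obtain \<sigma> \<delta> where \<sigma>: "\<sigma> / d > 0"
    and eq': "transition_mat B \<sigma> *\<^sub>v map_vec complex_of_real x = \<delta> \<cdot>\<^sub>v map_vec complex_of_real y"
  proof (cases "d > 0")
    case True
    then show ?thesis using that[of \<tau> \<gamma>] \<tau> eq by simp
  next
    case False
    then show ?thesis
      using that[of "- \<tau>" "cnj \<gamma>"] \<tau> d transition_mat_uminus_mult_real[OF B x eq]
      by (simp add: divide_pos_neg)
  qed
  have "transition_mat (c \<cdot>\<^sub>m 1\<^sub>m n + d \<cdot>\<^sub>m B) (\<sigma> / d) *\<^sub>v map_vec complex_of_real x
      = (cis (\<sigma> / d * c) * \<delta>) \<cdot>\<^sub>v map_vec complex_of_real y"
    using x by (simp add: transition_mat_affine_mult_vec[OF B d] eq' smult_smult_assoc)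
  then show ?thesis using \<sigma> unfolding perfect_state_transfer_def by blast
qed

lemma pretty_good_state_transfer_affine_imp:
  assumes B: "B \<in> carrier_mat n n" and d: "d \<noteq> 0"
    and x: "x \<in> carrier_vec n" and y: "y \<in> carrier_vec n"
    and "pretty_good_state_transfer B x y"
  shows "pretty_good_state_transfer (c \<cdot>\<^sub>m 1\<^sub>m n + d \<cdot>\<^sub>m B) x y"
proof -
  let ?x = "map_vec complex_of_real x" and ?y = "map_vec complex_of_real y"
  let ?L = "c \<cdot>\<^sub>m 1\<^sub>m n + d \<cdot>\<^sub>m B"
  obtain \<tau> \<gamma> where ind: "lin_indep_pair x y" and \<gamma>: "cmod \<gamma> = 1"
    and lim: "\<And>j. j < n \<Longrightarrow> (\<lambda>k. (transition_mat B (\<tau> k) *\<^sub>v ?x) $ j) \<longlonglongrightarrow> (\<gamma> \<cdot>\<^sub>v ?y) $ j"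
    using assms unfolding pretty_good_state_transfer_def by auto
  \<comment> \<open>The phases picked up by the shift need not converge; pass to a subsequence along which they do.\<close>
  have "\<forall>k. cis (\<tau> k / d * c) \<in> sphere 0 1" by simp
  then obtain \<delta> r where \<delta>: "\<delta> \<in> sphere 0 1" and r: "strict_mono (r :: nat \<Rightarrow> nat)"
    and phase: "((\<lambda>k. cis (\<tau> k / d * c)) \<circ> r) \<longlonglongrightarrow> \<delta>"
    using compact_sphere[of "0 :: complex" 1] unfolding compact_def by metis
  have "(\<lambda>k. (transition_mat ?L (\<tau> (r k) / d) *\<^sub>v ?x) $ j) \<longlonglongrightarrow> ((\<delta> * \<gamma>) \<cdot>\<^sub>v ?y) $ j"
    if j: "j < n" for j
  proof -
    have "(\<lambda>k. cis (\<tau> (r k) / d * c) * (transition_mat B (\<tau> (r k)) *\<^sub>v ?x) $ j)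
        \<longlonglongrightarrow> \<delta> * (\<gamma> \<cdot>\<^sub>v ?y) $ j"
      using tendsto_mult[OF phase LIMSEQ_subseq_LIMSEQ[OF lim[OF j] r]] by (simp add: o_def)
    then show ?thesis
      using j x y carrier_matD[OF transition_mat_carrier[OF B]]
      by (simp add: transition_mat_affine_mult_vec[OF B d] mult.assoc)
  qed
  moreover have "cmod (\<delta> * \<gamma>) = 1" using \<delta> \<gamma> by (simp add: norm_mult)
  ultimately show ?thesis
    using ind y unfolding pretty_good_state_transfer_def
    by (intro conjI exI[of _ "\<lambda>k. \<tau> (r k) / d"] exI[of _ "\<delta> * \<gamma>"]) auto
qed

lemma affine_mat_inverse:
  fixes B :: "'a :: field mat"
  assumes "B \<in> carrier_mat n n" "d \<noteq> 0"
  shows "B = (- (c / d)) \<cdot>\<^sub>m 1\<^sub>m n + (1 / d) \<cdot>\<^sub>m (c \<cdot>\<^sub>m 1\<^sub>m n + d \<cdot>\<^sub>m B)"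
  using assms by (intro eq_matI) (auto simp: field_simps)

lemma perfect_state_transfer_affine:
  assumes B: "B \<in> carrier_mat n n" and d: "d \<noteq> 0" and x: "x \<in> carrier_vec n"
  shows "perfect_state_transfer (c \<cdot>\<^sub>m 1\<^sub>m n + d \<cdot>\<^sub>m B) x y \<longleftrightarrow> perfect_state_transfer B x y"
proof
  assume L: "perfect_state_transfer (c \<cdot>\<^sub>m 1\<^sub>m n + d \<cdot>\<^sub>m B) x y"
  show "perfect_state_transfer B x y"
    using perfect_state_transfer_affine_imp[OF _ _ x L, of "1 / d" "- (c / d)"] B d
    by (simp add: affine_mat_inverse[OF B d, of c, symmetric])
qed (use perfect_state_transfer_affine_imp[OF assms] in blast)

lemma pretty_good_state_transfer_affine:
  assumes B: "B \<in> carrier_mat n n" and d: "d \<noteq> 0"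
    and x: "x \<in> carrier_vec n" and y: "y \<in> carrier_vec n"
  shows "pretty_good_state_transfer (c \<cdot>\<^sub>m 1\<^sub>m n + d \<cdot>\<^sub>m B) x y \<longleftrightarrow> pretty_good_state_transfer B x y"
proof
  assume L: "pretty_good_state_transfer (c \<cdot>\<^sub>m 1\<^sub>m n + d \<cdot>\<^sub>m B) x y"
  show "pretty_good_state_transfer B x y"
    using pretty_good_state_transfer_affine_imp[OF _ _ x y L, of "1 / d" "- (c / d)"] B d
    by (simp add: affine_mat_inverse[OF B d, of c, symmetric])
qed (use pretty_good_state_transfer_affine_imp[OF assms] in blast)

section \<open>The path\<close>

lemma path_degree:
  assumes "n \<ge> 2" "i < n"
  shows "card {j. j < n \<and> path_adj i j} = (if i = 0 \<or> i = n - 1 then 1 else 2)"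
proof -
  have "{j. j < n \<and> path_adj i j} =
      (if i = 0 then {1} else if i = n - 1 then {n - 2} else {i - 1, i + 1})"
    using assms by (auto simp: path_adj_def)
  then show ?thesis using assms by auto
qed

lemma path_adjacency_carrier: "path_adjacency n p \<in> carrier_mat n n"
  by (simp add: path_adjacency_def potential_adjacency_mat_def adjacency_mat_def)

text \<open>The diagonal entry of the left-hand side at a vertex of degree \<open>deg\<close> and potential \<open>p\<close> is
  \<open>1 + (deg - 1 + p) q\<^sup>2\<close>. This is \<open>1 + q\<^sup>2\<close> at an inner vertex and
  \<open>1 + \<omega> q\<^sup>2 = (1 + q\<^sup>2) - q ((1 - \<omega>) q)\<close> at an end vertex.\<close>

lemma path_q_laplacian_affine:
  assumes "n \<ge> 2"
  shows "path_q_laplacian q n \<omega>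
       = (1 + q\<^sup>2) \<cdot>\<^sub>m 1\<^sub>m n + (- q) \<cdot>\<^sub>m path_adjacency n ((1 - \<omega>) * q)"
proof (rule eq_matI)
  fix i j
  assume "i < dim_row ((1 + q\<^sup>2) \<cdot>\<^sub>m 1\<^sub>m n + (- q) \<cdot>\<^sub>m path_adjacency n ((1 - \<omega>) * q))"
    and "j < dim_col ((1 + q\<^sup>2) \<cdot>\<^sub>m 1\<^sub>m n + (- q) \<cdot>\<^sub>m path_adjacency n ((1 - \<omega>) * q))"
  then have "i < n" "j < n" using path_adjacency_carrier[of n "(1 - \<omega>) * q"] by auto
  then show "path_q_laplacian q n \<omega> $$ (i, j)
      = ((1 + q\<^sup>2) \<cdot>\<^sub>m 1\<^sub>m n + (- q) \<cdot>\<^sub>m path_adjacency n ((1 - \<omega>) * q)) $$ (i, j)"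
    using path_degree[OF assms]
    by (auto simp: path_q_laplacian_def potential_q_laplacian_mat_def path_adjacency_def
        potential_adjacency_mat_def adjacency_mat_def degree_mat_def mat_diag_def
        end_potential_def path_adj_def algebra_simps power2_eq_square)
qed (auto simp: path_q_laplacian_def potential_q_laplacian_mat_def path_adjacency_def
        potential_adjacency_mat_def adjacency_mat_def degree_mat_def mat_diag_def)

theorem theorem8:
  fixes q \<omega> :: real and n :: nat and x y :: "real vec"
  assumes "q \<noteq> 0" and "n \<ge> 2" and "state n x" and "state n y"
  shows "(perfect_state_transfer (path_q_laplacian q n \<omega>) x y \<longleftrightarrow>
          perfect_state_transfer (path_adjacency n ((1 - \<omega>) * q)) x y) \<and>
         (pretty_good_state_transfer (path_q_laplacian q n \<omega>) x y \<longleftrightarrow>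
          pretty_good_state_transfer (path_adjacency n ((1 - \<omega>) * q)) x y)"
proof -
  have "- q \<noteq> 0" "x \<in> carrier_vec n" "y \<in> carrier_vec n"
    using assms by (auto simp: state_def)
  then show ?thesis
    unfolding path_q_laplacian_affine[OF \<open>n \<ge> 2\<close>]
    by (intro conjI perfect_state_transfer_affine[OF path_adjacency_carrier]
        pretty_good_state_transfer_affine[OF path_adjacency_carrier])
qed

end
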